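(* Let $m,n>1$ be coprime and let $\phi\in\mathbb F_q[X,Y]$ be bilinear over $\mathbb F_q$ with a representation \[\phi(X,Y)=\sum_{s=1}^r u_s(X)v_s(Y),\] where the $q$-polynomials $u_1,\dots,u_r\in\mathbb F_q[X]$ are linearly independent over $\mathbb F_q$, the $q$-polynomials $v_1,\dots,v_r\in\mathbb F_q[Y]$ are linearly independent over $\mathbb F_q$, and $\deg(u_s)<q^m$ and $\deg(v_s)<q^n$ for all $s$. The following are equivalent: (1) The $\phi$-product satisfies conjugate cancellation on $\mathcal N_q(m)\times\mathcal N_q(n)$. (2) There exist $(\alpha,\beta)\in\mathcal N_q(m)\times\mathcal N_q(n)$ with $\mathbb F_q(u_1(\alpha),\dots,u_r(\alpha))=\mathbb F_{q^m}$ and $\mathbb F_q(v_1(\beta),\dots,v_r(\beta))=\mathbb F_{q^n}$. (3) For all $(\alpha,\beta)\in\mathcal N_q(m)\times\mathcal N_q(n)$ we have $\mathbb F_q(u_1(\alpha),\dots,u_r(\alpha))=\mathbb F_{q^m}$ and $\mathbb F_q(v_1(\beta),\dots,v_r(\beta))=\mathbb F_{q^n}$.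
   Context: Let $q$ be a prime power and $\overline{\mathbb F}_q$ an algebraic closure of $\mathbb F_q$, with $\mathbb F_{q^n}\subseteq\overline{\mathbb F}_q$. An element $\alpha\in\mathbb F_{q^m}$ is normal over $\mathbb F_q$ if $\alpha,\alpha^q,\dots,\alpha^{q^{m-1}}$ are linearly independent over $\mathbb F_q$; $\mathcal N_q(m)$ is the set of elements of $\mathbb F_{q^m}$ that are normal over $\mathbb F_q$. A $q$-polynomial over $\mathbb F_q$ is a polynomial $u(X)=\sum_i c_iX^{q^i}$ with $c_i\in\mathbb F_q$. A polynomial $\phi\in\mathbb F_q[X,Y]$ is bilinear over $\mathbb F_q$ if it has the form $\sum_{i=0}^{m-1}\sum_{j=0}^{n-1}c_{ij}X^{q^i}Y^{q^j}$ with $c_{ij}\in\mathbb F_q$. The $\phi$-product is $\alpha\diamond\beta=\phi(\alpha,\beta)$. It satisfies conjugate cancellation on $\mathcal N_q(m)\times\mathcal N_q(n)$ if for every integer $k$ with $\gcd(m,n)\mid k$ and all $\alpha\in\mathcal N_q(m)$, $\beta\in\mathcal N_q(n)$: $\phi(\alpha,\beta)=\phi(\alpha^{q^k},\beta)$ implies $\alpha=\alpha^{q^k}$, and $\phi(\alpha,\beta)=\phi(\alpha,\beta^{q^k})$ implies $\beta=\beta^{q^k}$. (Here $x\mapsto x^{q^k}$ is the $k$-th power of the Frobenius automorphism.) *)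

theory Defs
  imports "HOL-Algebra.Algebraic_Closure_Type" "HOL-Algebra.Generated_Fields"
    "HOL-Library.Cardinality"
begin

text \<open>
  The base field is a type \<open>'k :: finite_field\<close>, so \<open>q = CARD('k)\<close>, and the ambient algebraic
  closure is \<open>'k alg_closure\<close>, with embedding \<open>to_ac\<close>.
\<close>

instance alg_closure :: (field_prime_char) field_prime_char
  by (rule field_prime_charI') simp

text \<open>The subfield with \<open>q\<^sup>n\<close> elements (cf.\ \<open>card_GF\<close> below).\<close>
definition GF :: "nat \<Rightarrow> 'k :: finite_field alg_closure set" where
  "GF n = {x. x ^ (CARD('k) ^ n) = x}"

text \<open>
  The \<open>k\<close>-th power of the Frobenius automorphism for an arbitrary integer \<open>k\<close>; for negative \<open>k\<close>
  it is the inverse function, see \<open>bij_power_card\<close> below.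
\<close>
definition Frob :: "int \<Rightarrow> 'k :: finite_field alg_closure \<Rightarrow> 'k alg_closure" where
  "Frob k x = (if k \<ge> 0 then x ^ (CARD('k) ^ nat k)
               else inv_into UNIV (\<lambda>y. y ^ (CARD('k) ^ nat (- k))) x)"

lemma of_nat_choose_CARD:
  assumes "0 < k" "k < CARD('k :: finite_field)"
  shows   "of_nat (CARD('k) choose k) = (0 :: 'k alg_closure)"
proof -
  define q where "q = CARD('k)"
  have q: "q > 0" by (simp add: q_def)
  define p where "p = (\<Sum>k\<in>{0<..<q}. Polynomial.monom (of_nat (q choose k) :: 'k) k)"
  have root: "poly p x = 0" for x
  proof -
    have "(x + 1) ^ q = (\<Sum>k\<le>q. of_nat (q choose k) * x ^ k)"
      by (subst binomial_ring) simp
    also have "{..q} = insert 0 (insert q {0<..<q})"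
      using q by auto
    also have "(\<Sum>k\<in>\<dots>. of_nat (q choose k) * x ^ k) = 1 + (x ^ q + poly p x)"
      using q by (simp add: p_def poly_sum Polynomial.poly_monom)
    finally show ?thesis
      by (simp add: q_def finite_field_power_card_eq_same)
  qed
  have "p = 0"
  proof (rule ccontr)
    assume "p \<noteq> 0"
    have "Polynomial.degree p \<le> q - 1"
      unfolding p_def
      by (intro Polynomial.degree_sum_le) (auto intro!: order.trans[OF Polynomial.degree_monom_le])
    moreover have "card {x. poly p x = 0} \<le> Polynomial.degree p"
      by (rule Polynomial.card_poly_roots_bound) fact
    moreover have "card {x. poly p x = 0} = q"
      using root by (simp add: q_def)
    ultimately show False
      using q by linarith
  qed
  hence "Polynomial.coeff p k = 0" by simp
  also have "Polynomial.coeff p k = of_nat (q choose k)"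
    using assms by (simp add: p_def Polynomial.coeff_sum Polynomial.coeff_monom q_def)
  finally show ?thesis
    by (simp add: of_nat_eq_0_iff_char_dvd q_def)
qed

lemma power_card_add:
  fixes x y :: "'k :: finite_field alg_closure"
  shows "(x + y) ^ (CARD('k) ^ j) = x ^ (CARD('k) ^ j) + y ^ (CARD('k) ^ j)"
proof -
  define q where "q = CARD('k)"
  have q: "q > 0" by (simp add: q_def)
  have step: "(x + y) ^ q = x ^ q + y ^ q" for x y :: "'k alg_closure"
  proof -
    have "(x + y) ^ q = (\<Sum>k\<le>q. of_nat (q choose k) * x ^ k * y ^ (q - k))"
      by (rule binomial_ring)
    also have "\<dots> = (\<Sum>k\<in>{0, q}. of_nat (q choose k) * x ^ k * y ^ (q - k))"
      by (intro sum.mono_neutral_right ballI) (auto simp: q_def of_nat_choose_CARD)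
    finally show ?thesis
      using q by (simp add: add_ac)
  qed
  show ?thesis
    unfolding q_def [symmetric]
    by (induction j arbitrary: x y) (simp_all add: power_mult step)
qed

lemma power_card_diff:
  fixes x y :: "'k :: finite_field alg_closure"
  shows "(x - y) ^ (CARD('k) ^ j) = x ^ (CARD('k) ^ j) - y ^ (CARD('k) ^ j)"
  using power_card_add[of "x - y" y j] by simp

lemma bij_power_card: "bij (\<lambda>x :: 'k :: finite_field alg_closure. x ^ (CARD('k) ^ j))"
proof (rule bijI)
  show "inj (\<lambda>x :: 'k alg_closure. x ^ (CARD('k) ^ j))"
  proof (rule injI)
    fix x y :: "'k alg_closure"
    assume "x ^ (CARD('k) ^ j) = y ^ (CARD('k) ^ j)"
    hence "(x - y) ^ (CARD('k) ^ j) = 0"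
      by (simp add: power_card_diff)
    thus "x = y" by simp
  qed
  show "surj (\<lambda>x :: 'k alg_closure. x ^ (CARD('k) ^ j))"
    unfolding surj_def
  proof
    fix y :: "'k alg_closure"
    have "CARD('k) ^ j > 0" by simp
    from nth_root_exists[OF this, of y] show "\<exists>x. y = x ^ (CARD('k) ^ j)"
      by metis
  qed
qed

lemma Frob_minus_Frob: "Frob (- k) (Frob k x) = (x :: 'k :: finite_field alg_closure)"
proof -
  have inj: "inj_on (\<lambda>y :: 'k alg_closure. y ^ (CARD('k) ^ j)) UNIV"
    and surj: "surj (\<lambda>y :: 'k alg_closure. y ^ (CARD('k) ^ j))" for j
    using bij_power_card[where 'k = 'k and j = j] by (auto simp: bij_def)
  show ?thesis
    using inv_into_f_f[OF inj[of "nat k"], of x]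
          f_inv_into_f[of x "\<lambda>y. y ^ (CARD('k) ^ nat (- k))" UNIV] surj[of "nat (- k)"]
    by (cases "k > 0"; cases "k = 0") (simp_all add: Frob_def)
qed

lemma card_GF:
  assumes "n > 0"
  shows   "card (GF n :: 'k :: finite_field alg_closure set) = CARD('k) ^ n"
proof -
  define Q where "Q = CARD('k) ^ n"
  define p where "p = Polynomial.monom (1 :: 'k alg_closure) Q - Polynomial.monom 1 1"
  have q1: "CARD('k) > 1"
    using card_mono[of "UNIV :: 'k set" "{0, 1}"] by simp
  hence Q1: "Q > 1"
    using assms unfolding Q_def by (intro one_less_power) auto
  have "of_nat CARD('k) = (0 :: 'k alg_closure)"
    using of_nat_choose_CARD[where 'k = 'k and k = 1] q1 by simp
  hence Q0: "of_nat Q = (0 :: 'k alg_closure)"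
    using assms by (simp add: Q_def)
  have pderiv: "pderiv p = - 1"
    by (simp add: p_def pderiv_diff pderiv_monom Q0 monom_0 one_pCons)
  have deg: "Polynomial.degree p = Q"
    unfolding p_def using Q1
    by (simp only: diff_conv_add_uminus, subst Polynomial.degree_add_eq_left)
       (simp_all add: Polynomial.degree_monom_eq)
  have "p \<noteq> 0" using deg Q1 by auto
  then obtain A where A: "size A = Polynomial.degree p"
      "p = Polynomial.smult (Polynomial.lead_coeff p) (\<Prod>x\<in>#A. [:-x, 1:])"
    using alg_closed_imp_factorization by blast
  have "count A x \<le> 1" for x
  proof (rule ccontr)
    assume "\<not> count A x \<le> 1"
    hence "{#x, x#} \<subseteq># A"
      by (auto simp: subseteq_mset_def)
    then obtain B where "A = {#x, x#} + B"
      using mset_subset_eq_exists_conv by blast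
    with A(2) obtain r where "p = [:-x, 1:] * ([:-x, 1:] * r)"
      by (metis (no_types, lifting) image_mset_add_mset add_mset_add_single union_mset_add_mset_left
          add_0 mult_smult_right prod_mset.add_mset)
    hence "poly (pderiv p) x = 0"
      by (simp add: pderiv_mult del: mult_pCons_left)
    thus False by (simp add: pderiv)
  qed
  hence "size A = card (set_mset A)"
    unfolding size_multiset_overloaded_eq
    by (metis (no_types, lifting) card_eq_sum count_greater_eq_one_iff order_antisym sum.cong)
  also have "set_mset A = {x. poly p x = 0}"
    using \<open>p \<noteq> 0\<close> by (subst A(2)) (auto simp: poly_prod_mset)
  finally have "card {x. poly p x = 0} = Polynomial.degree p"
    using A(1) by simp
  also have "{x. poly p x = 0} = GF n"
    by (auto simp: p_def GF_def Q_def Polynomial.poly_monom)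
  finally show ?thesis
    by (simp add: deg Q_def)
qed

text \<open>
  Linear independence of a family, i.e.\ repeated members make it dependent
  (\<^const>\<open>module.dependent\<close> alone speaks about the set of members).
\<close>
definition lin_indep_family ::
    "('k :: field \<Rightarrow> 'v \<Rightarrow> 'v :: ab_group_add) \<Rightarrow> ('i \<Rightarrow> 'v) \<Rightarrow> 'i set \<Rightarrow> bool" where
  "lin_indep_family scale f I \<longleftrightarrow> inj_on f I \<and> \<not> module.dependent scale (f ` I)"

lemma lin_indep_family_finite:
  assumes "vector_space scale" "finite I"
  shows   "lin_indep_family scale f I \<longleftrightarrow>
             (\<forall>c. (\<Sum>i\<in>I. scale (c i) (f i)) = 0 \<longrightarrow> (\<forall>i\<in>I. c i = 0))"
proof -
  interpret vector_space scale by fact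
  show ?thesis
  proof (intro iffI allI impI ballI)
    fix c i
    assume *: "lin_indep_family scale f I" "(\<Sum>i\<in>I. scale (c i) (f i)) = 0" "i \<in> I"
    hence inj: "inj_on f I" and ind: "independent (f ` I)"
      by (auto simp: lin_indep_family_def)
    define d where "d = (\<lambda>x. c (the_inv_into I f x))"
    have d: "d (f i) = c i" if "i \<in> I" for i
      using that inj by (simp add: d_def the_inv_into_f_f)
    have "(\<Sum>x\<in>f ` I. scale (d x) x) = (\<Sum>i\<in>I. scale (c i) (f i))"
      by (subst sum.reindex[OF inj]) (simp add: d)
    hence "d (f i) = 0"
      using independentD[OF ind, of "f ` I" d "f i"] * assms(2) by simp
    thus "c i = 0" using d *(3) by simp
  next
    assume *: "\<forall>c. (\<Sum>i\<in>I. scale (c i) (f i)) = 0 \<longrightarrow> (\<forall>i\<in>I. c i = 0)"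
    have inj: "inj_on f I"
    proof (rule inj_onI, rule ccontr)
      fix i j assume ij: "i \<in> I" "j \<in> I" "f i = f j" "i \<noteq> j"
      define c where "c = (\<lambda>k. if k = i then 1 else if k = j then -1 else 0 :: 'a)"
      have "(\<Sum>k\<in>I. scale (c k) (f k)) = (\<Sum>k\<in>{i, j}. scale (c k) (f k))"
        using ij assms(2) by (intro sum.mono_neutral_right) (auto simp: c_def)
      also have "\<dots> = 0"
        using ij by (simp add: c_def)
      finally have "c i = 0" using * ij by blast
      thus False by (simp add: c_def)
    qed
    moreover have "independent (f ` I)"
    proof (rule independent_if_scalars_zero)
      fix u x
      assume "(\<Sum>x\<in>f ` I. scale (u x) x) = 0" "x \<in> f ` I"
      moreover from this have "(\<Sum>i\<in>I. scale (u (f i)) (f i)) = 0"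
        by (simp add: sum.reindex[OF inj])
      ultimately show "u x = 0"
        using *[rule_format, of "\<lambda>i. u (f i)"] by auto
    qed (use assms in auto)
    ultimately show "lin_indep_family scale f I"
      by (simp add: lin_indep_family_def)
  qed
qed

definition ac_scale :: "'k :: field \<Rightarrow> 'k alg_closure \<Rightarrow> 'k alg_closure" where
  "ac_scale c x = to_ac c * x"

lemma vector_space_ac_scale: "vector_space ac_scale"
  by unfold_locales (simp_all add: ac_scale_def algebra_simps)

lemma vector_space_poly: "vector_space (Polynomial.smult :: 'k :: field \<Rightarrow> 'k poly \<Rightarrow> 'k poly)"
  by unfold_locales (simp_all add: smult_add_right smult_add_left)

definition normal_elements :: "nat \<Rightarrow> 'k :: finite_field alg_closure set" where
  "normal_elements m =
     {\<alpha> \<in> GF m. lin_indep_family ac_scale (\<lambda>i. \<alpha> ^ (CARD('k) ^ i)) {..<m}}"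

definition adjoin :: "'k :: field alg_closure set \<Rightarrow> 'k alg_closure set" where
  "adjoin S = generate_field ring_of_type_algebra (range to_ac \<union> S)"

definition q_polynomial :: "'k :: finite_field poly \<Rightarrow> bool" where
  "q_polynomial u \<longleftrightarrow> (\<exists>d c. u = (\<Sum>i<d. Polynomial.monom (c i) (CARD('k) ^ i)))"

definition ac_eval :: "'k :: field poly \<Rightarrow> 'k alg_closure \<Rightarrow> 'k alg_closure" where
  "ac_eval u x = poly (map_poly to_ac u) x"

text \<open>
  \<open>F[X,Y]\<close> is represented as \<open>F[X][Y]\<close>, i.e.\ the outer variable of \<open>'k poly poly\<close> is \<open>Y\<close>.
\<close>
definition in_X :: "'k :: field poly \<Rightarrow> 'k poly poly" where
  "in_X u = [:u:]"

definition in_Y :: "'k :: field poly \<Rightarrow> 'k poly poly" where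
  "in_Y v = map_poly (\<lambda>c. [:c:]) v"

definition ac_eval2 :: "'k :: field poly poly \<Rightarrow> 'k alg_closure \<Rightarrow> 'k alg_closure \<Rightarrow> 'k alg_closure" where
  "ac_eval2 \<phi> x y = poly (map_poly (\<lambda>p. ac_eval p x) \<phi>) y"

lemma ac_eval_0 [simp]: "ac_eval 0 x = 0"
  by (simp add: ac_eval_def)

lemma ac_eval_smult: "ac_eval (Polynomial.smult c u) x = to_ac c * ac_eval u x"
proof -
  have "map_poly to_ac (Polynomial.smult c u) = Polynomial.smult (to_ac c) (map_poly to_ac u)"
    by (rule Polynomial.poly_eqI) (simp add: coeff_map_poly)
  thus ?thesis by (simp add: ac_eval_def)
qed

lemma ac_eval2_in_X_in_Y: "ac_eval2 (in_X u * in_Y v) x y = ac_eval u x * ac_eval v y"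
proof -
  have "map_poly (\<lambda>p. ac_eval p x) (in_X u * in_Y v) =
          Polynomial.smult (ac_eval u x) (map_poly to_ac v)"
    by (rule Polynomial.poly_eqI)
       (simp add: in_X_def in_Y_def coeff_map_poly ac_eval_smult mult.commute)
  thus ?thesis by (simp add: ac_eval2_def ac_eval_def)
qed

definition bilinear_poly :: "nat \<Rightarrow> nat \<Rightarrow> 'k :: finite_field poly poly \<Rightarrow> bool" where
  "bilinear_poly m n \<phi> \<longleftrightarrow>
     (\<exists>c. \<phi> = (\<Sum>i<m. \<Sum>j<n. Polynomial.monom (Polynomial.monom (c i j) (CARD('k) ^ i)) (CARD('k) ^ j)))"

definition conjugate_cancellation :: "nat \<Rightarrow> nat \<Rightarrow> 'k :: finite_field poly poly \<Rightarrow> bool" where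
  "conjugate_cancellation m n \<phi> \<longleftrightarrow>
     (\<forall>k :: int. int (gcd m n) dvd k \<longrightarrow>
        (\<forall>\<alpha> \<in> normal_elements m. \<forall>\<beta> \<in> normal_elements n.
           (ac_eval2 \<phi> \<alpha> \<beta> = ac_eval2 \<phi> (Frob k \<alpha>) \<beta> \<longrightarrow> \<alpha> = Frob k \<alpha>) \<and>
           (ac_eval2 \<phi> \<alpha> \<beta> = ac_eval2 \<phi> \<alpha> (Frob k \<beta>) \<longrightarrow> \<beta> = Frob k \<beta>)))"

end

theory Submission
  imports Defs
begin

text \<open>
  Let \<open>\<beta>\<close> be normal. The values \<open>v\<^sub>s(\<beta>)\<close> are linearly independent over \<open>F\<^sub>q\<close>, because a relation
  between them is a relation between the conjugates of \<open>\<beta>\<close>, and they stay independent over \<open>GF m\<close>,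
  since \<open>GF m\<close> and \<open>GF n\<close> are linearly disjoint. Hence \<open>\<phi>(\<alpha>, \<beta>) = \<phi>(\<alpha>\<^bsup>q^k\<^esup>, \<beta>)\<close> holds iff every
  \<open>u\<^sub>s(\<alpha>)\<close> is fixed by the \<open>k\<close>-th power of the Frobenius, that is, iff the field generated by
  the \<open>u\<^sub>s(\<alpha>)\<close> lies in \<open>GF k\<close>. This condition does not depend on the normal element \<open>\<alpha>\<close>: every
  element of \<open>GF m\<close> is a linear combination of conjugates of \<open>\<alpha>\<close>, and \<open>u\<^sub>s\<close> is linear and commutes
  with the Frobenius. So cancellation in the first argument says exactly that these values
  generate \<open>GF m\<close>. Passing from all normal elements to some of them uses the normal basis theorem.
  Note that \<open>GF 0\<close> is the whole algebraic closure, in accordance with the trivial power \<open>k = 0\<close>.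
\<close>

section \<open>Finite subfields and the Frobenius\<close>

lemma one_less_card_field: "CARD('k :: finite_field) > 1"
  using card_mono[of "UNIV :: 'k set" "{0, 1}"] by simp

lemma to_ac_power_card [simp]:
  "to_ac (c :: 'k :: finite_field) ^ (CARD('k) ^ j) = to_ac c"
proof (induction j)
  case (Suc j)
  have "to_ac c ^ CARD('k) = to_ac c"
    by (simp flip: to_ac_power add: finite_field_power_card_eq_same)
  with Suc show ?case by (simp add: power_mult)
qed simp

lemma power_card_sum:
  fixes f :: "'a \<Rightarrow> 'k :: finite_field alg_closure"
  shows "(\<Sum>i\<in>A. f i) ^ (CARD('k) ^ j) = (\<Sum>i\<in>A. f i ^ (CARD('k) ^ j))"
  by (induction A rule: infinite_finite_induct) (simp_all add: power_card_add)

lemma GF_add: "x \<in> GF j \<Longrightarrow> y \<in> GF j \<Longrightarrow> x + y \<in> GF j"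
  by (simp add: GF_def power_card_add)

lemma GF_diff: "x \<in> GF j \<Longrightarrow> y \<in> GF j \<Longrightarrow> x - y \<in> GF j"
  by (simp add: GF_def power_card_diff)

lemma GF_mult: "x \<in> GF j \<Longrightarrow> y \<in> GF j \<Longrightarrow> x * y \<in> GF j"
  by (simp add: GF_def power_mult_distrib)

lemma GF_inverse: "x \<in> GF j \<Longrightarrow> inverse x \<in> GF j"
  by (simp add: GF_def power_inverse)

lemma GF_power: "x \<in> GF j \<Longrightarrow> x ^ k \<in> GF j"
  unfolding GF_def mem_Collect_eq by (metis power_commutes power_mult mult.commute)

lemma to_ac_in_GF: "to_ac c \<in> GF j"
  by (simp add: GF_def)

lemma zero_in_GF: "0 \<in> GF j"
  by (simp add: GF_def)

lemma GF_sum: "(\<And>i. i \<in> A \<Longrightarrow> f i \<in> GF j) \<Longrightarrow> (\<Sum>i\<in>A. f i) \<in> GF j"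
  by (induction A rule: infinite_finite_induct) (auto simp: zero_in_GF GF_add)

lemma finite_GF: "n > 0 \<Longrightarrow> finite (GF n :: 'k :: finite_field alg_closure set)"
  using card_GF[of n, where 'k = 'k] by (intro card_ge_0_finite) simp

text \<open>The scalars lie in \<open>GF 1\<close>, and both sets have q elements. In the descent
  argument this turns a fixed point of the Frobenius into a scalar.\<close>

lemma GF_1: "GF 1 = range (to_ac :: 'k :: finite_field \<Rightarrow> _)"
proof -
  have "card (range (to_ac :: 'k \<Rightarrow> _)) = card (GF 1 :: 'k alg_closure set)"
    by (simp add: card_image[OF inj_to_ac] card_GF)
  thus ?thesis
    by (intro card_subset_eq[symmetric] finite_GF) (auto simp: to_ac_in_GF)
qed

lemma GF_power_card_mult:
  assumes "(x :: 'k :: finite_field alg_closure) \<in> GF m"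
  shows   "x ^ (CARD('k) ^ (m * k)) = x"
proof (induction k)
  case (Suc k)
  thus ?case using assms by (simp add: GF_def power_add power_mult)
qed simp

lemma GF_power_card_mod:
  assumes "(x :: 'k :: finite_field alg_closure) \<in> GF m"
  shows   "x ^ (CARD('k) ^ (j mod m)) = x ^ (CARD('k) ^ j)"
proof -
  have "x ^ (CARD('k) ^ j) = x ^ (CARD('k) ^ (m * (j div m) + j mod m))"
    by simp
  also have "\<dots> = x ^ (CARD('k) ^ (j mod m))"
    by (simp only: power_add power_mult[of x] GF_power_card_mult[OF assms])
  finally show ?thesis ..
qed

text \<open>The m-th power of the Frobenius is trivial on \<open>GF m\<close>, so any integer
  exponent, negative ones included, may be replaced by its residue mod m. Afterwards only ordinary
  powers occur.\<close>

lemma Frob_eq_power_mod: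
  assumes "(x :: 'k :: finite_field alg_closure) \<in> GF m" "m > 0"
  shows   "Frob k x = x ^ (CARD('k) ^ nat (k mod int m))"
proof (cases "k \<ge> 0")
  case True
  thus ?thesis
    using GF_power_card_mod[OF assms(1), of "nat k"]
    by (simp add: Frob_def nat_mod_distrib)
next
  case False
  \<comment> \<open>\<open>y\<close> is the claimed value of \<open>Frob k x\<close>. Applying
    \<open>Frob (- k)\<close> to it gives \<open>x\<close>, because the exponents add up to a
    multiple of m.\<close>
  define y where "y = x ^ (CARD('k) ^ nat (k mod int m))"
  have "int m dvd k mod int m + (- k)"
    by (metis dvd_minus_mod dvd_minus_iff minus_diff_eq uminus_add_conv_diff add.commute)
  moreover have "k mod int m + (- k) = int (nat (k mod int m) + nat (- k))"
    using False assms(2) by simp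
  ultimately have "m dvd nat (k mod int m) + nat (- k)"
    by (metis int_dvd_int_iff)
  then obtain l where l: "nat (k mod int m) + nat (- k) = m * l" by blast
  have "Frob (- k) y = x ^ (CARD('k) ^ (nat (k mod int m) + nat (- k)))"
    using False by (simp add: Frob_def y_def power_add power_mult)
  also have "\<dots> = x"
    using GF_power_card_mult[OF assms(1)] l by simp
  finally have "Frob k x = Frob (- (- k)) (Frob (- k) y)" by simp
  thus ?thesis by (simp only: Frob_minus_Frob y_def)
qed

text \<open>Coordinates with respect to \<open>B\<close> identify the span with functions from
  \<open>B\<close> to the scalars; extensional functions represent each coordinate vector
  once.\<close>

lemma (in vector_space) card_span_independent:
  assumes "finite B" "independent B"
  shows   "card (span B) = CARD('a) ^ card B"
proof -
  have "bij_betw (\<lambda>c. \<Sum>b\<in>B. scale (c b) b) (B \<rightarrow>\<^sub>E UNIV) (span B)"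
    unfolding bij_betw_def
  proof
    show "inj_on (\<lambda>c. \<Sum>b\<in>B. scale (c b) b) (B \<rightarrow>\<^sub>E UNIV)"
    proof (rule inj_onI)
      fix c d :: "'b \<Rightarrow> 'a"
      assume cd: "c \<in> B \<rightarrow>\<^sub>E UNIV" "d \<in> B \<rightarrow>\<^sub>E UNIV"
        and eq: "(\<Sum>b\<in>B. scale (c b) b) = (\<Sum>b\<in>B. scale (d b) b)"
      have "(\<Sum>b\<in>B. scale (c b - d b) b) = 0"
        using eq by (simp add: scale_left_diff_distrib sum_subtractf)
      hence "c b - d b = 0" if "b \<in> B" for b
        using independentD[OF assms(2,1), of "\<lambda>b. c b - d b" b] that by simp
      thus "c = d" using cd by (intro PiE_ext[of c B _ d]) auto
    qed
    show "(\<lambda>c. \<Sum>b\<in>B. scale (c b) b) ` (B \<rightarrow>\<^sub>E UNIV) = span B"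
    proof -
      have "(\<Sum>b\<in>B. scale (u b) b) \<in> (\<lambda>c. \<Sum>b\<in>B. scale (c b) b) ` (B \<rightarrow>\<^sub>E UNIV)" for u
        by (rule image_eqI[of _ _ "restrict u B"]) auto
      thus ?thesis unfolding span_finite[OF assms(1)] by auto
    qed
  qed
  from bij_betw_same_card[OF this] assms(1) show ?thesis
    by (simp add: card_PiE)
qed

section \<open>Subspaces over the base field and finite subrings\<close>

interpretation ac: vector_space "ac_scale :: 'k :: field \<Rightarrow> _"
  by (rule vector_space_ac_scale)

lemma subspace_GF: "ac.subspace (GF j)"
  by (rule ac.subspaceI) (auto simp: zero_in_GF ac_scale_def intro: GF_add GF_mult to_ac_in_GF)

text \<open>As a vector space over the base field, \<open>K\<close> has q^d elements. Multiplication
  by a nonzero x permutes the nonzero elements, so comparing products gives x^(|K|-1) = 1 and puts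
  \<open>K\<close> inside \<open>GF d\<close>; counting gives equality.\<close>

lemma finite_subring_eq_GF:
  fixes K :: "'k :: finite_field alg_closure set"
  assumes fin: "finite K" and base: "range to_ac \<subseteq> K"
    and add: "\<And>x y. x \<in> K \<Longrightarrow> y \<in> K \<Longrightarrow> x + y \<in> K"
    and mult: "\<And>x y. x \<in> K \<Longrightarrow> y \<in> K \<Longrightarrow> x * y \<in> K"
  shows "\<exists>d. K = GF d"
proof -
  have 01: "0 \<in> K" "1 \<in> K"
    using base rangeI[of to_ac "0 :: 'k"] rangeI[of to_ac "1 :: 'k"] by auto
  have "ac.subspace K"
    using 01 base by (intro ac.subspaceI) (auto simp: ac_scale_def intro: add mult)
  obtain B where B: "B \<subseteq> K" "ac.independent B" "K \<subseteq> ac.span B"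
    using ac.maximal_independent_subset by blast
  have "ac.span B = K"
    using B \<open>ac.subspace K\<close> by (intro ac.span_subspace)
  hence cardK: "card K = CARD('k) ^ card B"
    using ac.card_span_independent[of B] B finite_subset[OF _ fin] by simp
  \<comment> \<open>Since 0 and 1 are distinct, the dimension is positive, as \<open>card_GF\<close>
    requires.\<close>
  have "card {0, 1 :: 'k alg_closure} \<le> card K"
    using 01 fin by (intro card_mono) auto
  hence "card B > 0" using cardK by (cases "card B") auto
  have "x ^ card K = x" if x: "x \<in> K" for x
  proof (cases "x = 0")
    case False
    let ?K = "K - {0}"
    have "bij_betw (\<lambda>y. x * y) ?K ?K"
      using False x mult
      by (intro bij_betw_imageI endo_inj_surj) (auto simp: inj_on_def fin)
    hence "(\<Prod>y\<in>?K. y) = (\<Prod>y\<in>?K. x * y)"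
      by (rule prod.reindex_bij_betw[symmetric])
    also have "\<dots> = x ^ card ?K * (\<Prod>y\<in>?K. y)"
      by (simp add: prod.distrib)
    finally have "x ^ card ?K = 1"
      using fin by simp
    moreover have "card K = Suc (card ?K)"
      using 01(1) fin by (metis card.remove)
    ultimately show ?thesis by simp
  qed (use fin 01 in \<open>auto simp: card_gt_0_iff\<close>)
  hence "K \<subseteq> GF (card B)"
    by (auto simp: GF_def cardK)
  thus ?thesis
    using card_subset_eq[OF finite_GF[OF \<open>card B > 0\<close>]] card_GF[OF \<open>card B > 0\<close>, where 'k = 'k] cardK
    by metis
qed

section \<open>Generated subfields\<close>

lemma adjoin_add: "x \<in> adjoin S \<Longrightarrow> y \<in> adjoin S \<Longrightarrow> x + y \<in> adjoin S"
  using generate_field.eng_add[of x ring_of_type_algebra "range to_ac \<union> S" y]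
  by (simp add: adjoin_def ring_of_type_algebra_def)

lemma adjoin_mult: "x \<in> adjoin S \<Longrightarrow> y \<in> adjoin S \<Longrightarrow> x * y \<in> adjoin S"
  using generate_field.eng_mult[of x ring_of_type_algebra "range to_ac \<union> S" y]
  by (simp add: adjoin_def ring_of_type_algebra_def)

lemma adjoin_superset: "range to_ac \<union> S \<subseteq> adjoin S"
  unfolding adjoin_def by (auto intro: generate_field.incl)

lemma adjoin_subset_GF:
  assumes "S \<subseteq> GF j"
  shows   "adjoin S \<subseteq> GF j"
proof
  interpret R: field "ring_of_type_algebra :: 'a alg_closure ring"
    by (rule field_from_type_algebra)
  have neg: "\<ominus>\<^bsub>ring_of_type_algebra\<^esub> x = - x" for x :: "'a alg_closure"
    by (rule R.minus_equality) (simp_all add: ring_of_type_algebra_def)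
  have inv: "x \<noteq> 0 \<Longrightarrow> inv\<^bsub>ring_of_type_algebra\<^esub> x = inverse x" for x :: "'a alg_closure"
    by (rule R.comm_inv_char) (simp_all add: ring_of_type_algebra_def)
  fix x assume "x \<in> adjoin S"
  thus "x \<in> GF j"
    unfolding adjoin_def
  proof (induction rule: generate_field.induct)
    case one
    show ?case using to_ac_in_GF[of 1] by (simp add: ring_of_type_algebra_def)
  next
    case (incl h)
    thus ?case using assms by (auto simp: to_ac_in_GF)
  next
    case (a_inv h)
    thus ?case using GF_diff[OF zero_in_GF, of h] by (simp add: neg)
  next
    case (m_inv h)
    hence "h \<noteq> 0" by (simp add: ring_of_type_algebra_def)
    with m_inv show ?case by (simp add: inv GF_inverse)
  qed (simp_all add: ring_of_type_algebra_def GF_add GF_mult)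
qed

text \<open>The generated field is finite, hence some \<open>GF d\<close>, and it contains
  \<open>S\<close>; taking j = d in the criterion gives the inclusion that is not obvious. The
  criterion speaks of fixed points only, which is the form that cancellation produces.\<close>

lemma adjoin_eq_GF_iff:
  fixes S :: "'k :: finite_field alg_closure set"
  assumes "S \<subseteq> GF m" "m > 0"
  shows   "adjoin S = GF m \<longleftrightarrow> (\<forall>j. S \<subseteq> GF j \<longrightarrow> (GF m :: 'k alg_closure set) \<subseteq> GF j)"
proof
  assume "adjoin S = GF m"
  thus "\<forall>j. S \<subseteq> GF j \<longrightarrow> (GF m :: 'k alg_closure set) \<subseteq> GF j"
    using adjoin_subset_GF[of S] by simp
next
  assume *: "\<forall>j. S \<subseteq> GF j \<longrightarrow> (GF m :: 'k alg_closure set) \<subseteq> GF j"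
  have sub: "adjoin S \<subseteq> GF m" by (rule adjoin_subset_GF) fact
  obtain d where d: "adjoin S = GF d"
    using finite_subring_eq_GF[of "adjoin S"] finite_subset[OF sub finite_GF[OF assms(2)]]
      adjoin_superset[of S] adjoin_add adjoin_mult by blast
  with adjoin_superset[of S] * have "GF m \<subseteq> adjoin S" by auto
  with sub show "adjoin S = GF m" by blast
qed

section \<open>q-polynomials at normal elements\<close>

text \<open>The m independent conjugates span q^m elements of \<open>GF m\<close>, which is all of
  it.\<close>

lemma normal_span:
  assumes "(\<alpha> :: 'k :: finite_field alg_closure) \<in> normal_elements m" "m > 0"
  shows   "ac.span ((\<lambda>i. \<alpha> ^ (CARD('k) ^ i)) ` {..<m}) = GF m"
proof -
  let ?B = "(\<lambda>i. \<alpha> ^ (CARD('k) ^ i)) ` {..<m}"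
  have *: "\<alpha> \<in> GF m" "inj_on (\<lambda>i. \<alpha> ^ (CARD('k) ^ i)) {..<m}" "ac.independent ?B"
    using assms(1) by (auto simp: normal_elements_def lin_indep_family_def)
  have "card (ac.span ?B) = CARD('k) ^ m"
    using ac.card_span_independent[of ?B] * by (simp add: card_image)
  moreover have "ac.span ?B \<subseteq> GF m"
    using * by (intro ac.span_minimal subspace_GF) (auto intro: GF_power)
  ultimately show ?thesis
    using card_subset_eq[OF finite_GF[OF assms(2)]] card_GF[OF assms(2), where 'k = 'k] by metis
qed

text \<open>A Frobenius-stable subspace containing a normal element contains its conjugates and
  therefore their span. This is how a property of one normal element is carried over to all of
  \<open>GF m\<close>.\<close>

lemma GF_subset_if_normal:
  assumes "(\<alpha> :: 'k :: finite_field alg_closure) \<in> normal_elements m" "m > 0"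
    and "\<alpha> \<in> V" "ac.subspace V" and frob: "\<And>x i. x \<in> V \<Longrightarrow> x ^ (CARD('k) ^ i) \<in> V"
  shows "GF m \<subseteq> V"
proof -
  have "ac.span ((\<lambda>i. \<alpha> ^ (CARD('k) ^ i)) ` {..<m}) \<subseteq> V"
    using assms by (intro ac.span_minimal) auto
  thus ?thesis using normal_span[OF assms(1,2)] by simp
qed

section \<open>Evaluation of polynomials and of q-polynomials\<close>

lemma ac_eval_add: "ac_eval (p + r) x = ac_eval p x + ac_eval r x"
proof -
  have "map_poly to_ac (p + r) = map_poly to_ac p + map_poly to_ac r"
    by (rule Polynomial.poly_eqI) (simp add: coeff_map_poly)
  thus ?thesis by (simp add: ac_eval_def)
qed

lemma ac_eval_sum: "ac_eval (\<Sum>i\<in>A. p i) x = (\<Sum>i\<in>A. ac_eval (p i) x)"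
  by (induction A rule: infinite_finite_induct) (simp_all add: ac_eval_add)

lemma ac_eval_monom: "ac_eval (Polynomial.monom c k) x = to_ac c * x ^ k"
  by (simp add: ac_eval_def map_poly_monom Polynomial.poly_monom)

lemma ac_eval2_add: "ac_eval2 (p + r) x y = ac_eval2 p x y + ac_eval2 r x y"
proof -
  have "map_poly (\<lambda>p. ac_eval p x) (p + r) =
          map_poly (\<lambda>p. ac_eval p x) p + map_poly (\<lambda>p. ac_eval p x) r"
    by (rule Polynomial.poly_eqI) (simp add: coeff_map_poly ac_eval_add)
  thus ?thesis by (simp add: ac_eval2_def)
qed

lemma ac_eval2_sum: "ac_eval2 (\<Sum>i\<in>A. p i) x y = (\<Sum>i\<in>A. ac_eval2 (p i) x y)"
  by (induction A rule: infinite_finite_induct)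
     (simp_all add: ac_eval2_add, simp_all add: ac_eval2_def)

lemma q_polynomial_coeff_eq_0:
  assumes "q_polynomial (w :: 'k :: finite_field poly)" "\<And>i. k \<noteq> CARD('k) ^ i"
  shows   "Polynomial.coeff w k = 0"
proof -
  obtain d c where "w = (\<Sum>i<d. Polynomial.monom (c i) (CARD('k) ^ i))"
    using assms(1) by (auto simp: q_polynomial_def)
  moreover have "CARD('k) ^ i \<noteq> k" for i
    using assms(2)[of i] by simp
  ultimately show ?thesis
    by (simp add: Polynomial.coeff_sum Polynomial.coeff_monom)
qed

text \<open>The number of terms in the definition of a q-polynomial is arbitrary; the degree bound
  cuts it down to the m exponents that match the conjugates of a normal element.\<close>

lemma ac_eval_q_polynomial:
  assumes "q_polynomial (w :: 'k :: finite_field poly)" "Polynomial.degree w < CARD('k) ^ m"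
  shows   "ac_eval w x = (\<Sum>i<m. to_ac (Polynomial.coeff w (CARD('k) ^ i)) * x ^ (CARD('k) ^ i))"
proof -
  have "w = (\<Sum>i<m. Polynomial.monom (Polynomial.coeff w (CARD('k) ^ i)) (CARD('k) ^ i))"
  proof (rule Polynomial.poly_eqI)
    fix k
    show "Polynomial.coeff w k = Polynomial.coeff
      (\<Sum>i<m. Polynomial.monom (Polynomial.coeff w (CARD('k) ^ i)) (CARD('k) ^ i)) k"
    proof (cases "\<exists>i. k = CARD('k) ^ i")
      case False
      thus ?thesis
        using q_polynomial_coeff_eq_0[OF assms(1), of k]
        by (auto simp: Polynomial.coeff_sum Polynomial.coeff_monom intro!: sum.neutral)
    next
      case True
      then obtain i where i: "k = CARD('k) ^ i" by blast
      have "Polynomial.coeff w k = 0" if "i \<ge> m"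
      proof (rule Polynomial.coeff_eq_0)
        have "CARD('k) ^ m \<le> CARD('k) ^ i"
          using that by (intro power_increasing) auto
        thus "Polynomial.degree w < k" using assms(2) i by simp
      qed
      \<comment> \<open>As q > 1, the map from i to q^i is injective, so at most one summand
        contributes to coefficient k.\<close>
      thus ?thesis
        using i one_less_card_field[where 'k = 'k]
        by (auto simp: Polynomial.coeff_sum Polynomial.coeff_monom sum.delta not_less)
    qed
  qed
  hence "ac_eval w x =
      ac_eval (\<Sum>i<m. Polynomial.monom (Polynomial.coeff w (CARD('k) ^ i)) (CARD('k) ^ i)) x"
    by simp
  thus ?thesis by (simp add: ac_eval_sum ac_eval_monom)
qed

text \<open>The coefficients lie in the base field and are fixed by the Frobenius, so evaluation
  commutes with it.\<close>

lemma ac_eval_power_card: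
  "ac_eval w ((x :: 'k :: finite_field alg_closure) ^ (CARD('k) ^ j)) = ac_eval w x ^ (CARD('k) ^ j)"
proof -
  have "(x ^ (CARD('k) ^ j)) ^ i = (x ^ i) ^ (CARD('k) ^ j)" for i
    by (metis power_mult mult.commute)
  thus ?thesis
    by (simp add: ac_eval_def poly_altdef power_card_sum coeff_map_poly power_mult_distrib)
qed

lemma ac_eval_in_GF: "x \<in> GF j \<Longrightarrow> ac_eval w x \<in> GF j"
  using ac_eval_power_card[of w x j] by (simp add: GF_def)

text \<open>A q-polynomial acts linearly over the base field, so preimages of subspaces are
  subspaces.\<close>

lemma subspace_ac_eval_vimage_GF:
  assumes "q_polynomial w"
  shows   "ac.subspace {x. ac_eval w x \<in> GF j}"
proof -
  obtain d c where w: "w = (\<Sum>i<d. Polynomial.monom (c i) (CARD('a) ^ i))"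
    using assms by (auto simp: q_polynomial_def)
  have eval: "ac_eval w x = (\<Sum>i<d. to_ac (c i) * x ^ (CARD('a) ^ i))" for x
    by (simp add: w ac_eval_sum ac_eval_monom)
  have "ac_eval w 0 = 0" by (simp add: eval power_0_left)
  moreover have "ac_eval w (x + y) = ac_eval w x + ac_eval w y" for x y
    by (simp add: eval power_card_add algebra_simps sum.distrib)
  moreover have "ac_eval w (ac_scale a x) = to_ac a * ac_eval w x" for a x
    by (simp add: eval ac_scale_def power_mult_distrib sum_distrib_left mult.left_commute)
  ultimately show ?thesis
    by (intro ac.subspaceI) (auto simp: zero_in_GF intro: GF_add GF_mult to_ac_in_GF)
qed

text \<open>The right-hand side does not mention \<alpha>, so the condition is the same for all
  normal elements.\<close>

lemma ac_eval_normal_in_GF_iff: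
  assumes "q_polynomial w" "\<alpha> \<in> normal_elements m" "m > 0"
  shows   "ac_eval w \<alpha> \<in> GF j \<longleftrightarrow> ac_eval w ` GF m \<subseteq> GF j"
proof
  assume *: "ac_eval w \<alpha> \<in> GF j"
  have "GF m \<subseteq> {x. ac_eval w x \<in> GF j}"
    by (rule GF_subset_if_normal[OF assms(2,3) _ subspace_ac_eval_vimage_GF[OF assms(1)]])
       (auto simp: * ac_eval_power_card intro: GF_power)
  thus "ac_eval w ` GF m \<subseteq> GF j" by blast
qed (use assms(2) in \<open>auto simp: normal_elements_def\<close>)

lemma normal_in_GF_iff:
  fixes \<alpha> :: "'k :: finite_field alg_closure"
  assumes "\<alpha> \<in> normal_elements m" "m > 0"
  shows   "\<alpha> \<in> GF j \<longleftrightarrow> (GF m :: 'k alg_closure set) \<subseteq> GF j"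
proof
  assume "\<alpha> \<in> GF j"
  show "(GF m :: 'k alg_closure set) \<subseteq> GF j"
    by (rule GF_subset_if_normal[OF assms \<open>\<alpha> \<in> GF j\<close> subspace_GF]) (rule GF_power)
qed (use assms(1) in \<open>auto simp: normal_elements_def\<close>)

text \<open>A relation between the values is a relation between the conjugates of \<beta>, with the
  coefficients of the combination \<open>w\<close> of the polynomials. These vanish by normality,
  the degree bound leaves no others, and so \<open>w = 0\<close>.\<close>

lemma ac_eval_normal_independent:
  fixes v :: "'i \<Rightarrow> 'k :: finite_field poly"
  assumes "finite I" "\<beta> \<in> normal_elements n" "lin_indep_family Polynomial.smult v I"
    and v: "\<And>s. s \<in> I \<Longrightarrow> q_polynomial (v s)"
    and deg: "\<And>s. s \<in> I \<Longrightarrow> Polynomial.degree (v s) < CARD('k) ^ n"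
    and eq: "(\<Sum>s\<in>I. to_ac (c s) * ac_eval (v s) \<beta>) = 0" and "t \<in> I"
  shows "c t = 0"
proof -
  define w where "w = (\<Sum>s\<in>I. Polynomial.smult (c s) (v s))"
  have "(\<Sum>i<n. ac_scale (Polynomial.coeff w (CARD('k) ^ i)) (\<beta> ^ (CARD('k) ^ i))) =
      (\<Sum>i<n. \<Sum>s\<in>I. to_ac (c s) * (to_ac (Polynomial.coeff (v s) (CARD('k) ^ i)) * \<beta> ^ (CARD('k) ^ i)))"
    by (simp add: w_def ac_scale_def Polynomial.coeff_sum to_ac_sum sum_distrib_right mult.assoc)
  also have "\<dots> = (\<Sum>s\<in>I. to_ac (c s) * ac_eval (v s) \<beta>)"
    by (subst sum.swap) (simp add: ac_eval_q_polynomial[OF v deg] sum_distrib_left)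
  finally have "(\<Sum>i<n. ac_scale (Polynomial.coeff w (CARD('k) ^ i)) (\<beta> ^ (CARD('k) ^ i))) = 0"
    using eq by simp
  moreover have "lin_indep_family ac_scale (\<lambda>i. \<beta> ^ (CARD('k) ^ i)) {..<n}"
    using assms(2) by (simp add: normal_elements_def)
  ultimately have coeff: "Polynomial.coeff w (CARD('k) ^ i) = 0" if "i < n" for i
    using that lin_indep_family_finite[OF vector_space_ac_scale, of "{..<n}"
        "\<lambda>i. \<beta> ^ (CARD('k) ^ i)"] by auto
  have "w = 0"
  proof (rule Polynomial.poly_eqI)
    fix k
    show "Polynomial.coeff w k = Polynomial.coeff 0 k"
    proof (cases "\<exists>i<n. k = CARD('k) ^ i")
      case True
      thus ?thesis using coeff by auto
    next
      case False
      \<comment> \<open>Such a k is either no power of q or at least q^n, beyond the degree of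
        \<open>v s\<close>.\<close>
      have "Polynomial.coeff (v s) k = 0" if s: "s \<in> I" for s
      proof (cases "\<exists>i. k = CARD('k) ^ i")
        case True
        then obtain i where i: "k = CARD('k) ^ i" "i \<ge> n" using False not_le by blast
        hence "CARD('k) ^ n \<le> k" by (auto intro: power_increasing)
        thus ?thesis using deg[OF s] by (intro Polynomial.coeff_eq_0) simp
      qed (use q_polynomial_coeff_eq_0[OF v[OF s], of k] in auto)
      thus ?thesis by (simp add: w_def Polynomial.coeff_sum)
    qed
  qed
  thus ?thesis
    using assms(3,7) lin_indep_family_finite[OF vector_space_poly assms(1), of v]
    by (auto simp: w_def)
qed

section \<open>Linear disjointness\<close>

text \<open>
  Artin's descent: an automorphism acting on \<open>GF m\<close> as the Frobenius and trivially on \<open>GF n\<close>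
  shortens a normalised linear relation.
\<close>
lemma GF_linearly_disjoint:
  fixes a b :: "'i \<Rightarrow> 'k :: finite_field alg_closure"
  assumes "coprime m n" "n > 0" "finite I"
    and "\<And>i. i \<in> I \<Longrightarrow> a i \<in> GF m" "\<And>i. i \<in> I \<Longrightarrow> b i \<in> GF n"
    and "\<And>c t. (\<Sum>i\<in>I. to_ac (c i) * b i) = 0 \<Longrightarrow> t \<in> I \<Longrightarrow> c t = 0"
    and "(\<Sum>i\<in>I. a i * b i) = 0" "j \<in> I"
  shows "a j = 0"
  using assms(3-8)
proof (induction I arbitrary: a j)
  case (insert t I)
  note aGF = insert.prems(1) and bGF = insert.prems(2) and indep = insert.prems(3)
  \<comment> \<open>A relation over \<open>I\<close> extends to \<open>insert t I\<close> with
    coefficient 0 at \<open>t\<close>.\<close>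
  have indep': "c i = 0" if "(\<Sum>i\<in>I. to_ac (c i) * b i) = 0" "i \<in> I" for c i
  proof -
    have "(\<Sum>i\<in>insert t I. to_ac ((c(t := 0)) i) * b i) = (\<Sum>i\<in>I. to_ac (c i) * b i)"
      using insert.hyps by (auto intro!: sum.cong)
    hence "(c(t := 0)) i = 0" using indep[of "c(t := 0)" i] that by simp
    thus ?thesis using insert.hyps that by (auto split: if_splits)
  qed
  have IH: "a' i = 0" if "\<And>i. i \<in> I \<Longrightarrow> a' i \<in> GF m" "(\<Sum>i\<in>I. a' i * b i) = 0" "i \<in> I" for a' i
    using insert.IH[of a' i] that bGF indep' by blast
  show ?case
  proof (cases "a t = 0")
    case True
    hence "(\<Sum>i\<in>I. a i * b i) = 0" using insert.prems(4) insert.hyps by simp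
    hence "a i = 0" if "i \<in> I" for i using IH[of a i] aGF that by blast
    with True show ?thesis using insert.prems(5) by blast
  next
    case False
    \<comment> \<open>Bezout gives an exponent that is 0 mod n and 1 mod m: the e-th power of the
      Frobenius is the required automorphism.\<close>
    obtain e x where e: "n dvd e" "e = m * x + 1"
    proof -
      obtain x y where "n * x = m * y + gcd n m"
        using bezout_nat[of n m] assms(2) by blast
      thus ?thesis
        using that[OF dvd_triv_left, of x y] assms(1) by (simp add: gcd.commute)
    qed
    define a' where "a' = (\<lambda>i. a i / a t)"
    have a'GF: "a' i \<in> GF m" if "i \<in> insert t I" for i
      using aGF that by (simp add: a'_def divide_inverse GF_mult GF_inverse)
    have a'_e: "a' i ^ (CARD('k) ^ e) = a' i ^ CARD('k)" if "i \<in> insert t I" for i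
      by (simp only: e(2) power_add power_mult[of "a' i"] GF_power_card_mult[OF a'GF[OF that]] power_one_right)
    have b_e: "b i ^ (CARD('k) ^ e) = b i" if "i \<in> insert t I" for i
      using GF_power_card_mult[OF bGF[OF that]] e(1) by auto
    have rel: "(\<Sum>i\<in>insert t I. a' i * b i) = 0"
    proof -
      have "(\<Sum>i\<in>insert t I. a' i * b i) = (\<Sum>i\<in>insert t I. a i * b i) / a t"
        by (simp only: a'_def sum_divide_distrib times_divide_eq_left)
      thus ?thesis using insert.prems(4) by simp
    qed
    have "(\<Sum>i\<in>insert t I. a' i ^ CARD('k) * b i) = (\<Sum>i\<in>insert t I. a' i * b i) ^ (CARD('k) ^ e)"
      unfolding power_card_sum by (rule sum.cong) (simp_all only: power_mult_distrib a'_e b_e)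
    hence "(\<Sum>i\<in>insert t I. (a' i ^ CARD('k) - a' i) * b i) = 0"
      by (simp only: rel left_diff_distrib sum_subtractf) simp
    moreover have "a' t = 1" using False by (simp add: a'_def)
    \<comment> \<open>Subtracting the relation from its image kills the term at \<open>t\<close>,
      where the coefficient is 1^q - 1 = 0. The induction hypothesis then applies to the
      differences.\<close>
    ultimately have "(\<Sum>i\<in>I. (a' i ^ CARD('k) - a' i) * b i) = 0"
      using insert.hyps by simp
    hence "a' i ^ CARD('k) - a' i = 0" if "i \<in> I" for i
      using IH[of "\<lambda>i. a' i ^ CARD('k) - a' i" i] that a'GF by (simp add: GF_diff GF_power)
    hence "a' i \<in> GF 1" if "i \<in> insert t I" for i
      using that \<open>a' t = 1\<close> by (auto simp: GF_def)
    hence "to_ac (of_ac (a' i)) = a' i" if "i \<in> insert t I" for i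
      using that GF_1 to_ac_of_ac by blast
    \<comment> \<open>All normalised coefficients are scalars now, so independence over the base
      field forces the coefficient at \<open>t\<close>, which is 1, to be 0.\<close>
    hence "(\<Sum>i\<in>insert t I. to_ac (of_ac (a' i)) * b i) = 0"
      using rel by (metis (no_types, lifting) sum.cong)
    hence "of_ac (a' t) = 0" by (intro indep) auto
    moreover have "of_ac (a' t) = 1" using \<open>a' t = 1\<close> by (intro of_ac_eqI) simp
    ultimately show ?thesis by simp
  qed
qed simp

section \<open>The normal basis theorem\<close>

text \<open>
  The action of \<open>F\<^sub>q[T]\<close> on the algebraic closure in which \<open>T\<close> acts as the \<open>q\<close>-Frobenius.
\<close>
definition frob_act :: "'k :: finite_field poly \<Rightarrow> 'k alg_closure \<Rightarrow> 'k alg_closure" where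
  "frob_act f x = (\<Sum>i\<le>Polynomial.degree f. to_ac (Polynomial.coeff f i) * x ^ (CARD('k) ^ i))"

lemma frob_act_altdef:
  assumes "Polynomial.degree (f :: 'k :: finite_field poly) \<le> N"
  shows   "frob_act f x = (\<Sum>i\<le>N. to_ac (Polynomial.coeff f i) * x ^ (CARD('k) ^ i))"
  unfolding frob_act_def using assms
  by (intro sum.mono_neutral_left) (auto simp: Polynomial.coeff_eq_0)

lemma frob_act_0_left [simp]: "frob_act 0 x = 0"
  by (simp add: frob_act_def)

lemma frob_act_0_right [simp]: "frob_act f 0 = 0"
  by (simp add: frob_act_def power_0_left)

lemma frob_act_1 [simp]: "frob_act 1 x = x"
  by (simp add: frob_act_def)

lemma frob_act_add_left: "frob_act (f + g) x = frob_act f x + frob_act g x"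
proof -
  define N where "N = max (Polynomial.degree f) (Polynomial.degree g)"
  have "Polynomial.degree (f + g) \<le> N"
    unfolding N_def by (rule Polynomial.degree_add_le) auto
  thus ?thesis
    using frob_act_altdef[of f N x] frob_act_altdef[of g N x] frob_act_altdef[of "f + g" N x]
    by (simp add: N_def algebra_simps sum.distrib)
qed

lemma frob_act_diff_left: "frob_act (f - g) x = frob_act f x - frob_act g x"
  using frob_act_add_left[of "f - g" g x] by simp

lemma frob_act_add_right: "frob_act f (x + y) = frob_act f x + frob_act f y"
  by (simp add: frob_act_def power_card_add algebra_simps sum.distrib)

lemma frob_act_monom:
  "frob_act (Polynomial.monom c i) (x :: 'k :: finite_field alg_closure) = to_ac c * x ^ (CARD('k) ^ i)"
proof -
  have "frob_act (Polynomial.monom c i) x =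
      (\<Sum>j\<le>i. to_ac (Polynomial.coeff (Polynomial.monom c i) j) * x ^ (CARD('k) ^ j))"
    by (rule frob_act_altdef) (rule Polynomial.degree_monom_le)
  also have "\<dots> = (\<Sum>j\<le>i. if i = j then to_ac c * x ^ (CARD('k) ^ j) else 0)"
    by (rule sum.cong) (auto simp: Polynomial.coeff_monom)
  finally show ?thesis by simp
qed

lemma frob_act_smult: "frob_act (Polynomial.smult c f) x = to_ac c * frob_act f x"
  using frob_act_altdef[OF Polynomial.degree_smult_le, of c f x]
  by (simp add: frob_act_def sum_distrib_left mult.assoc)

lemma frob_act_pCons:
  "frob_act (pCons c f) (x :: 'k :: finite_field alg_closure) = to_ac c * x + frob_act f x ^ CARD('k)"
proof -
  have "frob_act (pCons c f) x = (\<Sum>i\<le>Suc (Polynomial.degree f).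
          to_ac (Polynomial.coeff (pCons c f) i) * x ^ (CARD('k) ^ i))"
    by (rule frob_act_altdef) (rule Polynomial.degree_pCons_le)
  also have "\<dots> = to_ac c * x +
      (\<Sum>i\<le>Polynomial.degree f. to_ac (Polynomial.coeff f i) * x ^ (CARD('k) ^ Suc i))"
    by (subst sum.atMost_Suc_shift) simp
  also have "(\<Sum>i\<le>Polynomial.degree f. to_ac (Polynomial.coeff f i) * x ^ (CARD('k) ^ Suc i)) =
      frob_act f x ^ CARD('k)"
    using power_card_sum[of "\<lambda>i. to_ac (Polynomial.coeff f i) * x ^ (CARD('k) ^ i)"
        "{..Polynomial.degree f}" 1] to_ac_power_card[where 'k = 'k and j = 1]
    by (simp add: frob_act_def power_mult_distrib mult.commute flip: power_mult)
  finally show ?thesis .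
qed

text \<open>Scalars commute with the Frobenius, so products act as compositions. This makes the
  closure a module over a polynomial ring in one variable.\<close>

lemma frob_act_mult: "frob_act (f * g) x = frob_act f (frob_act g x)"
proof (induction f)
  case (pCons c f)
  have "frob_act (pCons c f * g) x = to_ac c * frob_act g x + frob_act (f * g) x ^ CARD('a)"
    by (simp only: mult_pCons_left frob_act_add_left frob_act_smult frob_act_pCons) simp
  thus ?case by (simp add: pCons.IH frob_act_pCons)
qed simp

lemma frob_act_in_GF: "x \<in> GF m \<Longrightarrow> frob_act f x \<in> GF m"
  unfolding frob_act_def by (intro GF_sum GF_mult to_ac_in_GF GF_power)

text \<open>Acting by f is evaluating a nonzero polynomial of degree at most q^(deg f), which would
  have all q^m elements of \<open>GF m\<close> as roots.\<close>

lemma frob_act_zero_on_GF_imp_degree: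
  assumes "f \<noteq> 0" "m > 0" and zero: "\<And>x. x \<in> GF m \<Longrightarrow> frob_act f x = 0"
  shows   "m \<le> Polynomial.degree (f :: 'k :: finite_field poly)"
proof -
  define q where "q = CARD('k)"
  have q: "q > 1" unfolding q_def by (rule one_less_card_field)
  define d where "d = Polynomial.degree f"
  define F where "F = (\<Sum>i\<le>d. Polynomial.monom (to_ac (Polynomial.coeff f i)) (q ^ i))"
  have poly_F: "poly F x = frob_act f x" for x
    by (simp add: F_def frob_act_def poly_sum Polynomial.poly_monom q_def d_def)
  have "Polynomial.coeff F (q ^ d) = (\<Sum>i\<le>d. if i = d then to_ac (Polynomial.coeff f i) else 0)"
    unfolding F_def Polynomial.coeff_sum Polynomial.coeff_monom
    using q by (intro sum.cong) auto
  also have "\<dots> = to_ac (Polynomial.lead_coeff f)" by (simp add: d_def)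
  finally have "F \<noteq> 0" using \<open>f \<noteq> 0\<close> by auto
  have "Polynomial.degree F \<le> q ^ d"
    unfolding F_def using q
    by (intro Polynomial.degree_sum_le)
       (auto intro!: order.trans[OF Polynomial.degree_monom_le] power_increasing)
  moreover have "card (GF m :: 'k alg_closure set) \<le> card {x. poly F x = 0}"
    using zero by (intro card_mono Polynomial.poly_roots_finite \<open>F \<noteq> 0\<close>) (auto simp: poly_F)
  moreover have "card {x. poly F x = 0} \<le> Polynomial.degree F"
    by (rule Polynomial.card_poly_roots_bound) fact
  ultimately have "q ^ m \<le> q ^ d"
    using card_GF[OF assms(2), where 'k = 'k] by (simp add: q_def)
  thus ?thesis using q power_le_imp_le_exp by (auto simp: d_def)
qed

text \<open>The generator of the annihilator ideal of \<open>x\<close> is determined only up to a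
  unit, hence a relation instead of a function.\<close>

definition annihilator :: "'k :: finite_field alg_closure \<Rightarrow> 'k poly \<Rightarrow> bool" where
  "annihilator x f \<longleftrightarrow> f \<noteq> 0 \<and> (\<forall>g. frob_act g x = 0 \<longleftrightarrow> f dvd g)"

text \<open>A nonzero polynomial of least degree killing \<open>x\<close> works, by division with
  remainder.\<close>

lemma annihilator_exists:
  assumes "g \<noteq> 0" "frob_act g x = 0"
  shows   "\<exists>f. annihilator x f"
proof -
  obtain f where f: "f \<noteq> 0" "frob_act f x = 0"
    and min: "\<And>h. h \<noteq> 0 \<and> frob_act h x = 0 \<Longrightarrow> Polynomial.degree f \<le> Polynomial.degree h"
    using ex_has_least_nat[of "\<lambda>h. h \<noteq> 0 \<and> frob_act h x = 0" g Polynomial.degree] assms by blast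
  have "f dvd h" if "frob_act h x = 0" for h
  proof (rule ccontr)
    assume "\<not> f dvd h"
    hence nz: "h mod f \<noteq> 0" by (simp add: dvd_eq_mod_eq_0)
    have "h mod f = h - (h div f) * f" by (simp add: minus_div_mult_eq_mod)
    hence "frob_act (h mod f) x = 0"
      by (simp add: frob_act_diff_left frob_act_mult f that)
    with min[of "h mod f"] nz Polynomial.degree_mod_less[OF f(1), of h] show False by auto
  qed
  moreover have "frob_act h x = 0" if "f dvd h" for h
    using that f by (auto simp: frob_act_mult mult.commute[of f])
  ultimately show ?thesis using f(1) by (auto simp: annihilator_def)
qed

text \<open>The polynomial T^m - 1 kills \<open>GF m\<close>. The degree bound is what later allows
  a choice of maximal degree.\<close>

lemma annihilator_exists_GF:
  assumes "(x :: 'k :: finite_field alg_closure) \<in> GF m" "m > 0"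
  obtains f where "annihilator x f" "Polynomial.degree f \<le> m"
proof -
  define L :: "'k poly" where "L = Polynomial.monom 1 m - 1"
  have act: "frob_act L x = 0"
    using assms(1) by (simp add: L_def frob_act_diff_left frob_act_monom GF_def)
  have "Polynomial.coeff L m = 1"
    using assms(2) by (simp add: L_def)
  hence "L \<noteq> 0" by auto
  then obtain f where f: "annihilator x f" using annihilator_exists act by blast
  have "Polynomial.degree L \<le> m"
    unfolding L_def by (intro Polynomial.degree_diff_le Polynomial.degree_monom_le) simp
  moreover have "Polynomial.degree f \<le> Polynomial.degree L"
    using f act \<open>L \<noteq> 0\<close> by (intro Polynomial.dvd_imp_degree_le) (auto simp: annihilator_def)
  ultimately show thesis using that f by auto
qed

lemma annihilator_not_unit: "annihilator x f \<Longrightarrow> x \<noteq> 0 \<Longrightarrow> \<not> f dvd 1"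
  by (metis annihilator_def frob_act_1)

lemma annihilator_0_imp_unit: "annihilator 0 f \<Longrightarrow> f dvd 1"
  by (metis annihilator_def frob_act_1)

lemma annihilator_frob_act:
  assumes "annihilator x (p * f)"
  shows   "annihilator (frob_act p x) f"
  using assms by (auto simp: annihilator_def mult.commute[of _ p] simp flip: frob_act_mult)

text \<open>If k kills \<open>x + y\<close>, then f k kills \<open>y\<close>, so g divides f k and
  by coprimality k; hence k kills both summands. Coprimality is stated as the cancellation rule used
  here.\<close>

lemma annihilator_add:
  assumes "annihilator x f" "annihilator y g" and coprime: "\<And>k. g dvd f * k \<Longrightarrow> g dvd k"
  shows   "annihilator (x + y) (f * g)"
  unfolding annihilator_def
proof (intro conjI allI)
  show "f * g \<noteq> 0" using assms(1,2) by (simp add: annihilator_def)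
  have x0: "frob_act f x = 0" and y0: "frob_act g y = 0"
    using assms(1,2) by (auto simp: annihilator_def)
  fix k
  show "frob_act k (x + y) = 0 \<longleftrightarrow> f * g dvd k"
  proof
    assume k: "frob_act k (x + y) = 0"
    have "frob_act (f * k) y = frob_act (f * k) (x + y) - frob_act (k * f) x"
      by (simp add: frob_act_add_right mult.commute)
    also have "\<dots> = 0"
      by (simp add: frob_act_mult k x0)
    finally have "g dvd f * k" using assms(2) by (simp add: annihilator_def)
    hence "g dvd k" by (rule coprime)
    hence "frob_act k y = 0" using assms(2) by (simp add: annihilator_def)
    hence "frob_act k x = 0" using k by (simp add: frob_act_add_right)
    hence "f dvd k" using assms(1) by (simp add: annihilator_def)
    then obtain l where "k = f * l" by blast
    \<comment> \<open>Since g divides k = f l, the cancellation rule makes it divide l.\<close>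
    with coprime[of l] \<open>g dvd k\<close> show "f * g dvd k" by (simp add: mult_dvd_mono)
  next
    assume "f * g dvd k"
    then obtain l where l: "k = f * g * l" by blast
    have "frob_act k (x + y) = frob_act ((g * l) * f) x + frob_act ((f * l) * g) y"
      by (simp add: l frob_act_add_right mult_ac)
    thus "frob_act k (x + y) = 0"
      by (simp only: frob_act_mult x0 y0) simp
  qed
qed

section \<open>Prime factors of polynomials over a field\<close>

lemma prime_elem_poly_dvd_exists:
  fixes f :: "'a :: field poly"
  assumes "f \<noteq> 0" "\<not> f dvd 1"
  obtains p where "prime_elem p" "p dvd f"
proof -
  have "\<exists>p. prime_elem p \<and> p dvd f"
    using assms
  proof (induction "Polynomial.degree f" arbitrary: f rule: less_induct)
    case less
    show ?case
    proof (cases "irreducible f")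
      case True
      thus ?thesis by (intro exI[of _ f] conjI field_poly_irreducible_imp_prime dvd_refl)
    next
      case False
      then obtain a b where ab: "f = a * b" "\<not> a dvd 1" "\<not> b dvd 1"
        using less.prems unfolding irreducible_def by blast
      have nz: "a \<noteq> 0" "b \<noteq> 0" using ab(1) less.prems(1) by simp_all
      have "Polynomial.degree b > 0"
        using ab(3) is_unit_iff_degree[OF nz(2)] by simp
      hence "Polynomial.degree a < Polynomial.degree f"
        using ab(1) nz by (simp add: Polynomial.degree_mult_eq)
      from less.hyps[OF this nz(1) ab(2)] ab(1) show ?thesis using dvd_mult2 by blast
    qed
  qed
  thus thesis using that by blast
qed

lemma prime_power_factor:
  fixes f p :: "'a :: field poly"
  assumes "f \<noteq> 0" "prime_elem p"
  obtains a h where "f = p ^ a * h" "\<not> p dvd h"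
proof -
  have "\<exists>a h. f = p ^ a * h \<and> \<not> p dvd h"
    using assms(1)
  proof (induction "Polynomial.degree f" arbitrary: f rule: less_induct)
    case less
    show ?case
    proof (cases "p dvd f")
      case False
      thus ?thesis by (intro exI[of _ 0] exI[of _ f]) simp
    next
      case True
      then obtain g where g: "f = p * g" by blast
      have nz: "p \<noteq> 0" "g \<noteq> 0" using g less.prems by simp_all
      have "Polynomial.degree p > 0"
        using assms(2) is_unit_iff_degree[OF nz(1)] by (simp add: prime_elem_def)
      hence "Polynomial.degree g < Polynomial.degree f"
        using g nz by (simp add: Polynomial.degree_mult_eq)
      from less.hyps[OF this nz(2)] obtain a h where "g = p ^ a * h" "\<not> p dvd h" by blast
      thus ?thesis using g by (intro exI[of _ "Suc a"] exI[of _ h]) simp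
    qed
  qed
  thus thesis using that by blast
qed

text \<open>
  If the annihilator \<open>f\<close> of \<open>\<alpha>\<close>, chosen of maximal degree, does not kill
  \<open>GF m\<close>, some \<open>\<beta>\<close> satisfies \<open>p f \<beta> = 0 \<noteq> f \<beta>\<close> for a prime \<open>p\<close>; with \<open>f = p\<^sup>a h\<close> and
  \<open>p\<close> not dividing \<open>h\<close>, the element \<open>p\<^sup>a \<alpha> + h \<beta>\<close> has the larger annihilator \<open>p f\<close>.
\<close>
lemma normal_elements_nonempty:
  assumes "m > 0"
  shows   "(normal_elements m :: 'k :: finite_field alg_closure set) \<noteq> {}"
proof -
  let ?P = "\<lambda>(x :: 'k alg_closure, f). x \<in> GF m \<and> annihilator x f"
  have deg_le: "Polynomial.degree f \<le> m" if xf: "x \<in> GF m" "annihilator x f" for x :: "'k alg_closure" and f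
  proof -
    obtain g where g: "annihilator x g" "Polynomial.degree g \<le> m"
      using annihilator_exists_GF[OF xf(1) assms] .
    have "f dvd g" "g \<noteq> 0" using g xf(2) by (auto simp: annihilator_def)
    thus ?thesis using g(2) Polynomial.dvd_imp_degree_le[of f g] by simp
  qed
  \<comment> \<open>The element 0 supplies a candidate; with the bound m on all degrees a pair of
    maximal degree exists.\<close>
  obtain f0 where "?P (0, f0)"
    using annihilator_exists_GF[OF zero_in_GF assms] zero_in_GF by (metis case_prodI)
  hence "\<exists>z. ?P z \<and> (\<forall>w. ?P w \<longrightarrow> Polynomial.degree (snd w) \<le> Polynomial.degree (snd z))"
    using deg_le by (intro ex_has_greatest_nat[of ?P _ _ "Suc m"]) (auto simp: less_Suc_eq_le)
  then obtain \<alpha> :: "'k alg_closure" and f where \<alpha>: "\<alpha> \<in> GF m" "annihilator \<alpha> f"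
    and max': "\<forall>w. ?P w \<longrightarrow> Polynomial.degree (snd w) \<le> Polynomial.degree f"
    by auto
  have max: "Polynomial.degree g \<le> Polynomial.degree f"
    if "x \<in> GF m" "annihilator x g" for x :: "'k alg_closure" and g
    using max'[rule_format, of "(x, g)"] that by simp
  have f0: "f \<noteq> 0" using \<alpha>(2) by (simp add: annihilator_def)
  have kill: "frob_act f y = 0" if y: "y \<in> GF m" for y
  proof (rule ccontr)
    assume ny: "frob_act f y \<noteq> 0"
    obtain g where g: "annihilator (frob_act f y) g"
      using annihilator_exists_GF[OF frob_act_in_GF[OF y] assms] .
    have "\<not> g dvd 1" "g \<noteq> 0"
      using g annihilator_not_unit[OF g ny] by (simp_all add: annihilator_def)
    then obtain p where p: "prime_elem p" "p dvd g"
      using prime_elem_poly_dvd_exists by blast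
    then obtain g' where g': "g = g' * p" by (metis dvdE mult.commute)
    \<comment> \<open>Removing the cofactor of p from the annihilator of f y leaves f \<beta> with
      annihilator exactly p.\<close>
    define \<beta> where "\<beta> = frob_act g' y"
    have \<beta>GF: "\<beta> \<in> GF m" unfolding \<beta>_def by (rule frob_act_in_GF) fact
    have "frob_act f \<beta> = frob_act g' (frob_act f y)"
      by (simp add: \<beta>_def mult.commute flip: frob_act_mult)
    hence ann_f\<beta>: "annihilator (frob_act f \<beta>) p"
      using annihilator_frob_act[of "frob_act f y" g' p] g g' by simp
    obtain a h where h: "f = p ^ a * h" "\<not> p dvd h"
      using prime_power_factor[OF f0 p(1)] .
    define x1 where "x1 = frob_act (p ^ a) \<alpha>"
    define x2 where "x2 = frob_act h \<beta>"
    have ann1: "annihilator x1 h"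
      unfolding x1_def by (rule annihilator_frob_act) (use \<alpha>(2) h(1) in simp)
    \<comment> \<open>The annihilator b of \<open>x2\<close> divides p^(a+1) but not p^a. So p does
      not divide the cofactor, and p^(a+1) divides b.\<close>
    have x2_iff: "frob_act k x2 = 0 \<longleftrightarrow> p ^ Suc a dvd k" for k
    proof
      assume k: "frob_act k x2 = 0"
      obtain b where b: "annihilator x2 b"
        using annihilator_exists_GF[OF frob_act_in_GF[OF \<beta>GF] assms] x2_def by metis
      have "frob_act (p ^ Suc a) x2 = frob_act p (frob_act f \<beta>)"
        by (simp add: x2_def h(1) mult.assoc flip: frob_act_mult)
      also have "\<dots> = 0" using ann_f\<beta> by (simp add: annihilator_def)
      finally have "b dvd p ^ Suc a" using b by (simp add: annihilator_def)
      have "frob_act (p ^ a) x2 = frob_act f \<beta>"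
        by (simp add: x2_def h(1) flip: frob_act_mult)
      moreover have "frob_act f \<beta> \<noteq> 0"
        using ann_f\<beta> p(1) annihilator_0_imp_unit by (metis prime_elem_not_unit)
      ultimately have "\<not> b dvd p ^ a" using b unfolding annihilator_def by metis
      obtain c where c: "p ^ Suc a = b * c" using \<open>b dvd p ^ Suc a\<close> by blast
      have "\<not> p dvd c"
      proof
        assume "p dvd c"
        then obtain c' where "c = p * c'" by blast
        with c have "p * p ^ a = p * (b * c')" by (simp add: mult_ac)
        hence "p ^ a = b * c'" using p(1) by (simp add: prime_elem_def)
        with \<open>\<not> b dvd p ^ a\<close> show False by simp
      qed
      hence "p ^ Suc a dvd b"
        using prime_power_dvd_multD[OF p(1), of "Suc a" c b] c by (simp add: mult.commute)
      moreover have "b dvd k" using b k by (simp add: annihilator_def)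
      ultimately show "p ^ Suc a dvd k" by (rule dvd_trans)
    next
      assume "p ^ Suc a dvd k"
      then obtain l where l: "k = l * p ^ Suc a" by (metis dvdE mult.commute)
      have "frob_act k x2 = frob_act l (frob_act p (frob_act f \<beta>))"
        by (simp add: x2_def h(1) l mult.assoc flip: frob_act_mult)
      also have "frob_act p (frob_act f \<beta>) = 0" using ann_f\<beta> by (simp add: annihilator_def)
      finally show "frob_act k x2 = 0" by simp
    qed
    have p0: "p \<noteq> 0" using p(1) by (simp add: prime_elem_def)
    hence ann2: "annihilator x2 (p ^ Suc a)"
      using x2_iff by (simp add: annihilator_def)
    have "annihilator (x1 + x2) (h * p ^ Suc a)"
      using annihilator_add[OF ann1 ann2] prime_power_dvd_multD[OF p(1), of "Suc a" h] h(2)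
      by blast
    moreover have "x1 + x2 \<in> GF m"
      unfolding x1_def x2_def by (intro GF_add frob_act_in_GF \<alpha>(1) \<beta>GF)
    moreover have "h * p ^ Suc a = p * f" by (simp add: h(1) mult_ac)
    ultimately have "Polynomial.degree (p * f) \<le> Polynomial.degree f"
      using max by metis
    moreover have "Polynomial.degree p > 0"
      using p(1) is_unit_iff_degree[OF p0] by (simp add: prime_elem_def)
    ultimately show False
      using f0 p0 by (simp add: Polynomial.degree_mult_eq)
  qed
  \<comment> \<open>As f kills \<open>GF m\<close>, its degree is at least m. A relation between the
    m conjugates of \<alpha> is a multiple of f of degree below m, hence zero.\<close>
  have deg_f: "m \<le> Polynomial.degree f"
    using frob_act_zero_on_GF_imp_degree[OF f0 assms kill] .
  have "lin_indep_family ac_scale (\<lambda>i. \<alpha> ^ (CARD('k) ^ i)) {..<m}"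
    unfolding lin_indep_family_finite[OF vector_space_ac_scale finite_lessThan]
  proof (intro allI impI ballI)
    fix c :: "nat \<Rightarrow> 'k" and i
    assume c: "(\<Sum>i<m. ac_scale (c i) (\<alpha> ^ (CARD('k) ^ i))) = 0" and i: "i \<in> {..<m}"
    define g where "g = (\<Sum>i<m. Polynomial.monom (c i) i)"
    have "frob_act (\<Sum>i\<in>A. Polynomial.monom (c i) i) \<alpha> = (\<Sum>i\<in>A. ac_scale (c i) (\<alpha> ^ (CARD('k) ^ i)))" for A
      by (induction A rule: infinite_finite_induct)
         (simp_all add: frob_act_add_left frob_act_monom ac_scale_def)
    hence "frob_act g \<alpha> = 0" using c by (simp add: g_def)
    hence "f dvd g" using \<alpha>(2) by (simp add: annihilator_def)
    have coeff_g: "Polynomial.coeff g j = (if j < m then c j else 0)" for j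
      by (simp add: g_def Polynomial.coeff_sum Polynomial.coeff_monom)
    have "g = 0"
    proof (rule ccontr)
      assume "g \<noteq> 0"
      hence "m \<le> Polynomial.degree g"
        using Polynomial.dvd_imp_degree_le[OF \<open>f dvd g\<close>] deg_f by simp
      hence "Polynomial.lead_coeff g = 0" by (simp add: coeff_g)
      with \<open>g \<noteq> 0\<close> show False by simp
    qed
    thus "c i = 0" using coeff_g[of i] i by simp
  qed
  with \<alpha>(1) have "\<alpha> \<in> normal_elements m" by (simp add: normal_elements_def)
  thus ?thesis by blast
qed

section \<open>Conjugate cancellation\<close>

text \<open>Linear disjointness is applied to the differences of the \<open>u\<close>-values, which
  lie in \<open>GF m\<close>, and the \<open>v\<close>-values at \<beta>. Each difference vanishes
  exactly when the \<open>u\<close>-value is fixed by the j-th Frobenius power.\<close>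

lemma pairing_eq_iff:
  fixes \<alpha> \<beta> :: "'k :: finite_field alg_closure"
  assumes "coprime m n" "n > 0" "\<alpha> \<in> GF m" "\<beta> \<in> normal_elements n" "finite I"
    and "\<And>s. s \<in> I \<Longrightarrow> q_polynomial (v s)" "lin_indep_family Polynomial.smult v I"
    and "\<And>s. s \<in> I \<Longrightarrow> Polynomial.degree (v s) < CARD('k) ^ n"
  shows "(\<Sum>s\<in>I. ac_eval (u s) \<alpha> * ac_eval (v s) \<beta>) =
           (\<Sum>s\<in>I. ac_eval (u s) (\<alpha> ^ (CARD('k) ^ j)) * ac_eval (v s) \<beta>) \<longleftrightarrow>
         (\<forall>s\<in>I. ac_eval (u s) \<alpha> \<in> GF j)"
    (is "?L = ?R \<longleftrightarrow> _")
proof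
  assume "?L = ?R"
  hence rel: "(\<Sum>s\<in>I. (ac_eval (u s) \<alpha> - ac_eval (u s) (\<alpha> ^ (CARD('k) ^ j))) * ac_eval (v s) \<beta>) = 0"
    by (simp add: left_diff_distrib sum_subtractf)
  have \<beta>: "\<beta> \<in> GF n" using assms(4) by (simp add: normal_elements_def)
  have "ac_eval (u s) \<alpha> - ac_eval (u s) (\<alpha> ^ (CARD('k) ^ j)) = 0" if "s \<in> I" for s
  proof (rule GF_linearly_disjoint[OF assms(1,2,5) _ _ _ rel that])
    show "c t = 0" if "(\<Sum>s\<in>I. to_ac (c s) * ac_eval (v s) \<beta>) = 0" "t \<in> I" for c t
      using ac_eval_normal_independent[OF assms(5,4,7,6,8) that] .
  qed (auto intro: GF_diff ac_eval_in_GF GF_power assms(3) \<beta>)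
  thus "\<forall>s\<in>I. ac_eval (u s) \<alpha> \<in> GF j"
    by (simp add: GF_def ac_eval_power_card)
next
  assume "\<forall>s\<in>I. ac_eval (u s) \<alpha> \<in> GF j"
  thus "?L = ?R" by (intro sum.cong) (auto simp: GF_def ac_eval_power_card)
qed

lemma adjoin_ac_eval_normal_iff:
  assumes "\<alpha> \<in> normal_elements m" "m > 0"
  shows   "adjoin ((\<lambda>s. ac_eval (u s) \<alpha>) ` I) = GF m \<longleftrightarrow>
             (\<forall>j. (\<forall>s\<in>I. ac_eval (u s) \<alpha> \<in> GF j) \<longrightarrow> \<alpha> \<in> GF j)"
proof -
  have "(\<lambda>s. ac_eval (u s) \<alpha>) ` I \<subseteq> GF m"
    using assms(1) by (auto simp: normal_elements_def intro: ac_eval_in_GF)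
  from adjoin_eq_GF_iff[OF this assms(2)] show ?thesis
    by (simp add: normal_in_GF_iff[OF assms] image_subset_iff)
qed

text \<open>Both conditions in the preceding criterion are independent of the chosen normal
  element.\<close>

lemma adjoin_ac_eval_normal_eq_GF_cong:
  assumes "\<alpha> \<in> normal_elements m" "\<alpha>' \<in> normal_elements m" "m > 0"
    and u: "\<And>s. s \<in> I \<Longrightarrow> q_polynomial (u s)"
  shows "adjoin ((\<lambda>s. ac_eval (u s) \<alpha>) ` I) = GF m \<longleftrightarrow>
         adjoin ((\<lambda>s. ac_eval (u s) \<alpha>') ` I) = GF m"
proof -
  have "(\<forall>s\<in>I. ac_eval (u s) \<alpha> \<in> GF j) \<longleftrightarrow> (\<forall>s\<in>I. ac_eval (u s) \<alpha>' \<in> GF j)" for j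
    by (intro ball_cong refl)
       (simp only: ac_eval_normal_in_GF_iff[OF u assms(1,3)] ac_eval_normal_in_GF_iff[OF u assms(2,3)])
  moreover have "\<alpha> \<in> GF j \<longleftrightarrow> \<alpha>' \<in> GF j" for j
    by (simp only: normal_in_GF_iff[OF assms(1,3)] normal_in_GF_iff[OF assms(2,3)])
  ultimately show ?thesis
    by (simp only: adjoin_ac_eval_normal_iff[OF assms(1,3)] adjoin_ac_eval_normal_iff[OF assms(2,3)])
qed

text \<open>Integer exponents reduce to residues mod m, and every natural j is itself an integer
  exponent. So quantifying over k amounts to quantifying over the fields
  \<open>GF j\<close>.\<close>

lemma cancellation_iff_adjoin:
  fixes \<alpha> \<beta> :: "'k :: finite_field alg_closure"
  assumes "coprime m n" "m > 0" "n > 0" "\<alpha> \<in> normal_elements m" "\<beta> \<in> normal_elements n" "finite I"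
    and "\<And>s. s \<in> I \<Longrightarrow> q_polynomial (v s)" "lin_indep_family Polynomial.smult v I"
    and "\<And>s. s \<in> I \<Longrightarrow> Polynomial.degree (v s) < CARD('k) ^ n"
  shows "(\<forall>k. (\<Sum>s\<in>I. ac_eval (u s) \<alpha> * ac_eval (v s) \<beta>) =
              (\<Sum>s\<in>I. ac_eval (u s) (Frob k \<alpha>) * ac_eval (v s) \<beta>) \<longrightarrow> \<alpha> = Frob k \<alpha>) \<longleftrightarrow>
         adjoin ((\<lambda>s. ac_eval (u s) \<alpha>) ` I) = GF m"
    (is "(\<forall>k. ?P k) \<longleftrightarrow> _")
proof -
  have \<alpha>: "\<alpha> \<in> GF m" using assms(4) by (simp add: normal_elements_def)
  let ?Q = "\<lambda>j. (\<forall>s\<in>I. ac_eval (u s) \<alpha> \<in> GF j) \<longrightarrow> \<alpha> \<in> GF j"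
  have fixed: "\<alpha> = \<alpha> ^ (CARD('k) ^ j) \<longleftrightarrow> \<alpha> \<in> GF j" for j
    by (auto simp: GF_def)
  have mod: "?P k \<longleftrightarrow> ?Q (nat (k mod int m))" for k
    by (simp only: Frob_eq_power_mod[OF \<alpha> assms(2)] fixed
          pairing_eq_iff[OF assms(1,3) \<alpha> assms(5,6,7,8,9)])
  have "?P (int j) \<longleftrightarrow> ?Q j" for j
    unfolding Frob_def using fixed[of j] pairing_eq_iff[OF assms(1,3) \<alpha> assms(5,6,7,8,9), of u j]
    by simp
  with mod have "(\<forall>k. ?P k) \<longleftrightarrow> (\<forall>j. ?Q j)" by blast
  thus ?thesis by (simp only: adjoin_ac_eval_normal_iff[OF assms(4,2)])
qed

theorem theorem4p1:
  fixes m n r :: nat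
    and \<phi> :: "'k :: finite_field poly poly"
    and u v :: "nat \<Rightarrow> 'k poly"
  assumes "m > 1" and "n > 1" and "coprime m n"
    and "bilinear_poly m n \<phi>"
    and "\<phi> = (\<Sum>s = 1..r. in_X (u s) * in_Y (v s))"
    and "\<And>s. s \<in> {1..r} \<Longrightarrow> q_polynomial (u s)"
    and "\<And>s. s \<in> {1..r} \<Longrightarrow> q_polynomial (v s)"
    and "lin_indep_family smult u {1..r}"
    and "lin_indep_family smult v {1..r}"
    and "\<And>s. s \<in> {1..r} \<Longrightarrow> Polynomial.degree (u s) < CARD('k) ^ m"
    and "\<And>s. s \<in> {1..r} \<Longrightarrow> Polynomial.degree (v s) < CARD('k) ^ n"
  shows "(conjugate_cancellation m n \<phi> \<longleftrightarrow>
           (\<exists>\<alpha> \<in> normal_elements m. \<exists>\<beta> \<in> normal_elements n.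
              adjoin ((\<lambda>s. ac_eval (u s) \<alpha>) ` {1..r}) = GF m \<and>
              adjoin ((\<lambda>s. ac_eval (v s) \<beta>) ` {1..r}) = GF n))
       \<and> ((\<exists>\<alpha> \<in> normal_elements m. \<exists>\<beta> \<in> normal_elements n.
              adjoin ((\<lambda>s. ac_eval (u s) \<alpha>) ` {1..r}) = GF m \<and>
              adjoin ((\<lambda>s. ac_eval (v s) \<beta>) ` {1..r}) = GF n) \<longleftrightarrow>
           (\<forall>\<alpha> \<in> normal_elements m. \<forall>\<beta> \<in> normal_elements n.
              adjoin ((\<lambda>s. ac_eval (u s) \<alpha>) ` {1..r}) = GF m \<and>
              adjoin ((\<lambda>s. ac_eval (v s) \<beta>) ` {1..r}) = GF n))"
proof -
  let ?I = "{1..r}"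
  let ?U = "\<lambda>\<alpha>. adjoin ((\<lambda>s. ac_eval (u s) \<alpha>) ` ?I) = GF m"
  let ?V = "\<lambda>\<beta>. adjoin ((\<lambda>s. ac_eval (v s) \<beta>) ` ?I) = GF n"
  have pos: "m > 0" "n > 0" using assms(1,2) by simp_all
  have eval: "ac_eval2 \<phi> x y = (\<Sum>s\<in>?I. ac_eval (u s) x * ac_eval (v s) y)" for x y
    unfolding assms(5) by (simp only: ac_eval2_sum ac_eval2_in_X_in_Y)
  have "(\<forall>k. ac_eval2 \<phi> \<alpha> \<beta> = ac_eval2 \<phi> (Frob k \<alpha>) \<beta> \<longrightarrow> \<alpha> = Frob k \<alpha>) \<longleftrightarrow> ?U \<alpha>"
    if "\<alpha> \<in> normal_elements m" "\<beta> \<in> normal_elements n" for \<alpha> \<beta>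
    unfolding eval
    by (rule cancellation_iff_adjoin[OF assms(3) pos that finite_atLeastAtMost assms(7,9,11)])
  moreover have "(\<forall>k. ac_eval2 \<phi> \<alpha> \<beta> = ac_eval2 \<phi> \<alpha> (Frob k \<beta>) \<longrightarrow> \<beta> = Frob k \<beta>) \<longleftrightarrow> ?V \<beta>"
    if "\<alpha> \<in> normal_elements m" "\<beta> \<in> normal_elements n" for \<alpha> \<beta>
    \<comment> \<open>Exchanging the factors reduces the second argument to the first. The
      restricted pattern keeps the rewriting from swapping them back.\<close>
    unfolding eval mult.commute[of "ac_eval (u _) _"]
    by (rule cancellation_iff_adjoin[OF _ pos(2,1) that(2,1) finite_atLeastAtMost assms(6,8,10)])
       (simp_all add: assms(3) coprime_commute)
  ultimately have cancel: "conjugate_cancellation m n \<phi> \<longleftrightarrow>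
      (\<forall>\<alpha> \<in> normal_elements m. \<forall>\<beta> \<in> normal_elements n. ?U \<alpha> \<and> ?V \<beta>)"
    \<comment> \<open>For gcd 1 the divisibility condition holds for every integer k.\<close>
    using assms(3) unfolding conjugate_cancellation_def by (simp add: coprime_iff_gcd_eq_1) blast
  have U: "?U \<alpha> \<longleftrightarrow> ?U \<alpha>'" if "\<alpha> \<in> normal_elements m" "\<alpha>' \<in> normal_elements m" for \<alpha> \<alpha>'
    by (rule adjoin_ac_eval_normal_eq_GF_cong[OF that pos(1) assms(6)])
  have V: "?V \<beta> \<longleftrightarrow> ?V \<beta>'" if "\<beta> \<in> normal_elements n" "\<beta>' \<in> normal_elements n" for \<beta> \<beta>'
    by (rule adjoin_ac_eval_normal_eq_GF_cong[OF that pos(2) assms(7)])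
  \<comment> \<open>Without normal elements (3) would hold vacuously and (2) would fail.\<close>
  obtain \<alpha>\<^sub>0 \<beta>\<^sub>0 :: "'k alg_closure" where "\<alpha>\<^sub>0 \<in> normal_elements m" "\<beta>\<^sub>0 \<in> normal_elements n"
    using normal_elements_nonempty[OF pos(1)] normal_elements_nonempty[OF pos(2)] by blast
  hence "(\<exists>\<alpha> \<in> normal_elements m. \<exists>\<beta> \<in> normal_elements n. ?U \<alpha> \<and> ?V \<beta>) \<longleftrightarrow>
      (\<forall>\<alpha> \<in> normal_elements m. \<forall>\<beta> \<in> normal_elements n. ?U \<alpha> \<and> ?V \<beta>)"
    using U V by meson
  with cancel show ?thesis by simp
qed

end
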